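(* Let $B$ be a nucleation process and $G$ a growth process on $[t_0,T]$, and let $t\in[t_0,T]$. For every refinement sequence $\{\Pi_j\}_{j\in\mathbb N}$ of $[t_0,t]$, almost surely the limits (with respect to the Hausdorff distance $\delta_H$) $\lim_{j\to\infty}s_{\Pi_j}(t)$ and $\lim_{j\to\infty}S_{\Pi_j}(t)$ exist, and the four sets $$\overline{\bigcup_{j\in\mathbb N}s_{\Pi_j}(t)},\qquad \overline{\lim_{j\to\infty}s_{\Pi_j}(t)},\qquad \lim_{j\to\infty}S_{\Pi_j}(t),\qquad \bigcap_{j\in\mathbb N}S_{\Pi_j}(t)$$ are equal.
   Context: Setting. $\mathfrak X$ is a reflexive Banach space with separable dual; $[t_0,T]\subset\mathbb R$; $(\Omega,\mathfrak F,\{\mathfrak F_t\}_{t\in[t_0,T]},\mathbb P)$ is a filtered complete probability space satisfying the usual conditions. $\mathbb F(\mathfrak X)$ is the family of non-empty closed subsets of $\mathfrak X$. A set-valued map $X$ defined on a measurable space $(E,\mathcal E)$ with values in subsets of $\mathfrak X$ is measurable if $\{e: X(e)\cap O\neq\emptyset\}\in\mathcal E$ for every open $O\subseteq\mathfrak X$. The Hausdorff distance on $\mathbb F(\mathfrak X)$ (possibly $+\infty$) is $\delta_H(A,C)=\max\{\sup_{a\in A}\inf_{c\in C}\|a-c\|,\ \sup_{c\in C}\inf_{a\in A}\|a-c\|\}$; limits of sequences in $\mathbb F(\mathfrak X)$ are taken in $\mathbb F(\mathfrak X)$. Nucleation process: a map $B:\Omega\times[t_0,T]\to\mathbb F(\mathfrak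 X)$, $B_t=B(\cdot,t)$, such that $B_t$ is $\mathfrak F_t$-measurable for every $t$, and $B_s\subseteq B_t$ whenever $s<t$. Growth process: a map $G:\Omega\times[t_0,T]\to\mathbb F(\mathfrak X)$ such that for all $(\omega,t)$: $0\in G(\omega,t)$, $G(\omega,t)$ is convex, $G(\omega,t)\subseteq K$ for a fixed non-empty closed bounded set $K\subset\mathfrak X$ (independent of $\omega,t$), and $G$ is measurable with respect to the predictable $\sigma$-algebra $\mathcal P$ on $\Omega\times[t_0,T]$, i.e. the $\sigma$-algebra generated by the sets $A\times\{t_0\}$ with $A\in\mathfrak F_{t_0}$ and $A\times(s,t]$ with $A\in\mathfrak F_s$, $(s,t]\subset[t_0,T]$. For $a\le b$, $\int_a^b G(\tau)\,d\tau$ is the random set $\omega\mapsto\int_a^bG(\omega,\tau)\,d\tau$, the Aumann integral with respect to Lebesgue measure: $\{\int_a^b g(\tau)\,d\tau: g \text{ Bochner integrable on }[t_0,T],\ g(\tau)\in G(\omega,\tau)\text{ for a.e. }\tau\}$. Minkowski sum: $A+C=\{a+c:a\in A,c\in C\}$ (with $\emptyset+A=\emptyset$), and $A\oplus C=\overline{A+C}$. A partition of $[t_0,t]$ is $\Pi=(t_i)_{i=0}^n$ with $t_0<t_1<\dots<t_n=t$; its mesh is $|\Pi|=\max_i(t_i-t_{i-1})$. A refinement sequence of $[t_0,t]$ is a sequence of partitions $\{\Pi_j\}_{j\in\mathbb N}$ of $[t_0,t]$ with $|\Pi_j|\to0$ as $j\to\infty$. Put $\Delta B_{t_i}=B_{t_i}\setminus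 B_{t_{i-1}}^{o}$, where $B^{o}$ is the interior of $B$, and $$s_\Pi(t)=\Big(B_{t_0}\oplus\int_{t_0}^tG(\tau)d\tau\Big)\cup\bigcup_{i=1}^n\Big(\Delta B_{t_i}\oplus\int_{t_i}^tG(\tau)d\tau\Big),$$ $$S_\Pi(t)=\Big(B_{t_0}\oplus\int_{t_0}^tG(\tau)d\tau\Big)\cup\bigcup_{i=1}^n\Big(\Delta B_{t_i}\oplus\int_{t_{i-1}}^tG(\tau)d\tau\Big).$$ *)

theory Defs
  imports "HOL-Probability.Probability"
begin

text \<open>The dual of \<open>'a\<close> is the type \<open>'a \<Rightarrow>\<^sub>L real\<close> with the operator norm; reflexivity is
  surjectivity of the canonical embedding of \<open>'a\<close> into its bidual.\<close>

definition reflexive_space :: "'a::real_normed_vector itself \<Rightarrow> bool" where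
  "reflexive_space _ \<longleftrightarrow>
    (\<forall>\<phi> :: ('a \<Rightarrow>\<^sub>L real) \<Rightarrow>\<^sub>L real. \<exists>x :: 'a. \<forall>f :: 'a \<Rightarrow>\<^sub>L real.
       blinfun_apply \<phi> f = blinfun_apply f x)"

definition separable_dual :: "'a::real_normed_vector itself \<Rightarrow> bool" where
  "separable_dual _ \<longleftrightarrow> separable_space (euclidean :: ('a \<Rightarrow>\<^sub>L real) topology)"

definition closed_sets :: "'a::topological_space set set" where
  "closed_sets = {A. closed A \<and> A \<noteq> {}}"

definition hausdorff_dist :: "'a::real_normed_vector set \<Rightarrow> 'a set \<Rightarrow> ennreal" where
  "hausdorff_dist A C =
    max (SUP a\<in>A. INF c\<in>C. ennreal (norm (a - c)))
        (SUP c\<in>C. INF a\<in>A. ennreal (norm (a - c)))"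

text \<open>Convergence in the (extended) metric space of non-empty closed sets: both the sequence and
  its limit are required to lie in that space, which makes the limit unique.\<close>

definition hausdorff_tendsto :: "(nat \<Rightarrow> 'a::real_normed_vector set) \<Rightarrow> 'a set \<Rightarrow> bool" where
  "hausdorff_tendsto A L \<longleftrightarrow>
    (\<forall>j. A j \<in> closed_sets) \<and> L \<in> closed_sets \<and> (\<lambda>j. hausdorff_dist (A j) L) \<longlonglongrightarrow> 0"

text \<open>Only the values \<open>F t\<close> with \<open>t \<in> {t0..T}\<close> are relevant.\<close>

locale usual_filtered_prob_space = prob_space M + complete_measure M
  for M :: "'w measure" +
  fixes F :: "real \<Rightarrow> 'w measure" and t0 T :: real
  assumes subalgebra_F: "\<And>t. t \<in> {t0..T} \<Longrightarrow> subalgebra M (F t)"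
    and F_mono: "\<And>s t. t0 \<le> s \<Longrightarrow> s \<le> t \<Longrightarrow> t \<le> T \<Longrightarrow> sets (F s) \<subseteq> sets (F t)"
    and F_right_continuous: "\<And>t. t \<in> {t0..<T} \<Longrightarrow> sets (F t) = (\<Inter>s\<in>{t<..T}. sets (F s))"
    and F_null_sets: "null_sets M \<subseteq> sets (F t0)"

definition set_valued_measurable :: "'e measure \<Rightarrow> ('e \<Rightarrow> 'a::topological_space set) \<Rightarrow> bool" where
  "set_valued_measurable E X \<longleftrightarrow>
    (\<forall>U. open U \<longrightarrow> {e \<in> space E. X e \<inter> U \<noteq> {}} \<in> sets E)"

definition predictable_sigma ::
  "'w measure \<Rightarrow> (real \<Rightarrow> 'w measure) \<Rightarrow> real \<Rightarrow> real \<Rightarrow> ('w \<times> real) measure" where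
  "predictable_sigma M F t0 T =
    sigma (space M \<times> {t0..T})
      ({A \<times> {t0} | A. A \<in> sets (F t0)} \<union>
       {A \<times> {s<..t} | A s t. t0 \<le> s \<and> s < t \<and> t \<le> T \<and> A \<in> sets (F s)})"

definition nucleation_process ::
  "'w measure \<Rightarrow> (real \<Rightarrow> 'w measure) \<Rightarrow> real \<Rightarrow> real \<Rightarrow>
    ('w \<Rightarrow> real \<Rightarrow> 'a::real_normed_vector set) \<Rightarrow> bool" where
  "nucleation_process M F t0 T B \<longleftrightarrow>
    (\<forall>\<omega>\<in>space M. \<forall>t\<in>{t0..T}. B \<omega> t \<in> closed_sets) \<and>
    (\<forall>t\<in>{t0..T}. set_valued_measurable (F t) (\<lambda>\<omega>. B \<omega> t)) \<and>
    (\<forall>\<omega>\<in>space M. \<forall>s\<in>{t0..T}. \<forall>t\<in>{t0..T}. s < t \<longrightarrow> B \<omega> s \<subseteq> B \<omega> t)"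

definition growth_process ::
  "'w measure \<Rightarrow> (real \<Rightarrow> 'w measure) \<Rightarrow> real \<Rightarrow> real \<Rightarrow>
    ('w \<Rightarrow> real \<Rightarrow> 'a::real_normed_vector set) \<Rightarrow> bool" where
  "growth_process M F t0 T G \<longleftrightarrow>
    (\<forall>\<omega>\<in>space M. \<forall>t\<in>{t0..T}. G \<omega> t \<in> closed_sets \<and> 0 \<in> G \<omega> t \<and> convex (G \<omega> t)) \<and>
    (\<exists>K. K \<in> closed_sets \<and> bounded K \<and> (\<forall>\<omega>\<in>space M. \<forall>t\<in>{t0..T}. G \<omega> t \<subseteq> K)) \<and>
    set_valued_measurable (predictable_sigma M F t0 T) (\<lambda>(\<omega>, t). G \<omega> t)"

text \<open>The library's Bochner integral needs a second countable codomain. This is no extra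
  restriction for spaces with separable dual, since these are themselves separable.\<close>

definition aumann_integral ::
  "real \<Rightarrow> real \<Rightarrow> (real \<Rightarrow> 'a::{banach, second_countable_topology} set) \<Rightarrow> real \<Rightarrow> real \<Rightarrow> 'a set"
where
  "aumann_integral t0 T H a b =
    {(LINT \<tau>:{a..b}|lebesgue. g \<tau>) | g.
       set_integrable lebesgue {t0..T} g \<and> (AE \<tau>\<in>{t0..T} in lebesgue. g \<tau> \<in> H \<tau>)}"

definition closed_minkowski_sum :: "'a::real_normed_vector set \<Rightarrow> 'a set \<Rightarrow> 'a set"
    (infixl \<open>\<oplus>\<^sub>c\<close> 65) where
  "A \<oplus>\<^sub>c C = closure (A + C)"

text \<open>A partition \<open>a = t\<^sub>0 < \<dots> < t\<^sub>n = b\<close> is the list of its \<open>n + 1\<close> points. The case \<open>n = 0\<close> is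
  allowed, so that the degenerate interval \<open>a = b\<close> has the partition \<open>[a]\<close>, whose mesh is \<open>0\<close>.\<close>

definition is_partition :: "real list \<Rightarrow> real \<Rightarrow> real \<Rightarrow> bool" where
  "is_partition p a b \<longleftrightarrow> p \<noteq> [] \<and> sorted_wrt (<) p \<and> hd p = a \<and> last p = b"

definition mesh :: "real list \<Rightarrow> real" where
  "mesh p = Max (insert 0 {p ! i - p ! (i - 1) | i. i \<in> {1..<length p}})"

definition refinement_sequence :: "(nat \<Rightarrow> real list) \<Rightarrow> real \<Rightarrow> real \<Rightarrow> bool" where
  "refinement_sequence P a b \<longleftrightarrow> (\<forall>j. is_partition (P j) a b) \<and> (\<lambda>j. mesh (P j)) \<longlonglongrightarrow> 0"

text \<open>Both are for one fixed \<open>\<omega>\<close>: \<open>Bo\<close> and \<open>Go\<close> stand for \<open>B \<omega>\<close> and \<open>G \<omega>\<close>.\<close>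

definition increment :: "(real \<Rightarrow> 'a::topological_space set) \<Rightarrow> real list \<Rightarrow> nat \<Rightarrow> 'a set" where
  "increment Bo p i = Bo (p ! i) - interior (Bo (p ! (i - 1)))"

definition lower_sum ::
  "real \<Rightarrow> real \<Rightarrow> (real \<Rightarrow> 'a::{banach, second_countable_topology} set) \<Rightarrow> (real \<Rightarrow> 'a set) \<Rightarrow>
    real list \<Rightarrow> real \<Rightarrow> 'a set" where
  "lower_sum t0 T Bo Go p t =
    (Bo t0 \<oplus>\<^sub>c aumann_integral t0 T Go t0 t) \<union>
    (\<Union>i\<in>{1..<length p}. increment Bo p i \<oplus>\<^sub>c aumann_integral t0 T Go (p ! i) t)"

definition upper_sum ::
  "real \<Rightarrow> real \<Rightarrow> (real \<Rightarrow> 'a::{banach, second_countable_topology} set) \<Rightarrow> (real \<Rightarrow> 'a set) \<Rightarrow>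
    real list \<Rightarrow> real \<Rightarrow> 'a set" where
  "upper_sum t0 T Bo Go p t =
    (Bo t0 \<oplus>\<^sub>c aumann_integral t0 T Go t0 t) \<union>
    (\<Union>i\<in>{1..<length p}. increment Bo p i \<oplus>\<^sub>c aumann_integral t0 T Go (p ! (i - 1)) t)"

end

theory Submission
  imports Defs
begin

text \<open>The argument is pathwise and needs no null set. For any two partitions \<open>p\<close>, \<open>q\<close> of
  \<open>[t0, t]\<close> the lower sum of \<open>p\<close> is contained in the upper sum of \<open>q\<close>: a nucleus \<open>x\<close> that is
  present at time \<open>p ! i\<close> enters \<open>q\<close> at a first point \<open>q ! k\<close>, so \<open>q ! (k - 1) < p ! i\<close> by monotonicity,
  and the Aumann integral only increases when its lower limit decreases because \<open>0 \<in> G\<close>. On the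
  other hand the upper sum of \<open>p\<close> is within \<open>C * mesh p\<close> of its lower sum, where \<open>C\<close> bounds \<open>G\<close>.
  Hence the closure of the union of the lower sums and the intersection of the upper sums agree and
  are the limit of both sequences.\<close>

section \<open>Hausdorff distance and squeezed sequences of closed sets\<close>

text \<open>The slack \<delta> is there because the infima in the distance need not be attained, and
  because points of a closed Minkowski sum are only limits of sums. It vanishes by letting \<delta>
  tend to 0; nonnegativity of \<epsilon> lets \<open>ennreal\<close> split over \<epsilon> +
  \<delta>.\<close>

lemma hausdorff_dist_le:
  fixes A D :: "'a::real_normed_vector set"
  assumes "\<And>a \<delta>. a \<in> A \<Longrightarrow> \<delta> > 0 \<Longrightarrow> \<exists>d\<in>D. norm (a - d) \<le> \<epsilon> + \<delta>"
    and "\<And>d \<delta>. d \<in> D \<Longrightarrow> \<delta> > 0 \<Longrightarrow> \<exists>a\<in>A. norm (a - d) \<le> \<epsilon> + \<delta>"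
    and "0 \<le> \<epsilon>"
  shows "hausdorff_dist A D \<le> ennreal \<epsilon>"
proof -
  have *: "(INF z\<in>Z. ennreal (f z)) \<le> ennreal \<epsilon>"
    if approx: "\<And>\<delta>. \<delta> > 0 \<Longrightarrow> \<exists>z\<in>Z. f z \<le> \<epsilon> + \<delta>" for Z :: "'a set" and f :: "'a \<Rightarrow> real"
  proof (rule ennreal_le_epsilon)
    fix \<delta> :: real assume "\<delta> > 0"
    then obtain z where "z \<in> Z" "f z \<le> \<epsilon> + \<delta>" using approx by blast
    then have "(INF z\<in>Z. ennreal (f z)) \<le> ennreal (\<epsilon> + \<delta>)"
      by (meson INF_lower2 ennreal_leI)
    then show "(INF z\<in>Z. ennreal (f z)) \<le> ennreal \<epsilon> + ennreal \<delta>"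
      using \<open>\<delta> > 0\<close> \<open>0 \<le> \<epsilon>\<close> by simp
  qed
  show ?thesis
    unfolding hausdorff_dist_def
    by (intro max.boundedI SUP_least * assms(1,2))
qed

lemma hausdorff_tendsto_if_le:
  assumes "\<And>j. A j \<in> closed_sets" and "L \<in> closed_sets"
    and "\<And>j. hausdorff_dist (A j) L \<le> ennreal (\<epsilon> j)" and "\<epsilon> \<longlonglongrightarrow> 0"
  shows "hausdorff_tendsto A L"
proof -
  have "(\<lambda>j. ennreal (\<epsilon> j)) \<longlonglongrightarrow> 0"
    using tendsto_ennrealI[OF assms(4)] by simp
  then have "(\<lambda>j. hausdorff_dist (A j) L) \<longlonglongrightarrow> 0"
    by (rule tendsto_sandwich[OF _ _ tendsto_const, rotated -1]) (auto simp: assms(3))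
  then show ?thesis
    using assms(1,2) by (auto simp: hausdorff_tendsto_def)
qed

text \<open>The intersection U of the sets \<open>S j\<close> satisfies \<open>s j\<close>
  \<subseteq> U \<subseteq> \<open>S j\<close> for each j, so the gap \<epsilon> j between
  \<open>s j\<close> and \<open>S j\<close> bounds the distance of both to U. Neither sequence is
  monotone, since successive partitions need not be nested; the inclusion for all pairs i, j
  replaces monotonicity.\<close>

lemma hausdorff_limit_between:
  fixes s S :: "nat \<Rightarrow> 'a::real_normed_vector set"
  assumes closed_s: "\<And>j. s j \<in> closed_sets" and closed_S: "\<And>j. S j \<in> closed_sets"
    and sub: "\<And>i j. s i \<subseteq> S j"
    and near: "\<And>j x \<delta>. x \<in> S j \<Longrightarrow> \<delta> > 0 \<Longrightarrow> \<exists>y\<in>s j. norm (y - x) \<le> \<epsilon> j + \<delta>"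
    and nonneg: "\<And>j. 0 \<le> \<epsilon> j" and lim: "\<epsilon> \<longlonglongrightarrow> 0"
  shows "hausdorff_tendsto s (\<Inter>j. S j)" and "hausdorff_tendsto S (\<Inter>j. S j)"
    and "closure (\<Union>j. s j) = (\<Inter>j. S j)"
proof -
  let ?U = "\<Inter>j. S j"
  have s_U: "s j \<subseteq> ?U" for j using sub by blast
  have U_S: "?U \<subseteq> S j" for j by blast
  \<comment> \<open>U is nonempty because it contains \<open>s 0\<close>.\<close>
  have U: "?U \<in> closed_sets"
    using closed_s[of 0] closed_S s_U[of 0] by (auto simp: closed_sets_def)
  show "closure (\<Union>j. s j) = ?U"
  proof
    show "closure (\<Union>j. s j) \<subseteq> ?U"
      by (rule closure_minimal) (use s_U U in \<open>auto simp: closed_sets_def\<close>)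
    show "?U \<subseteq> closure (\<Union>j. s j)"
    proof
      fix x assume x: "x \<in> ?U"
      have "\<exists>y\<in>\<Union>j. s j. dist y x < e" if "e > 0" for e :: real
      proof -
        \<comment> \<open>A single index suffices: half of e pays for \<epsilon> j, the other half
          for the slack in \<open>near\<close>.\<close>
        have "\<forall>\<^sub>F j in sequentially. \<epsilon> j < e / 2"
          using order_tendstoD(2)[OF lim, of "e / 2"] that by simp
        then obtain j where "\<epsilon> j < e / 2"
          by (auto dest: eventually_happens)
        moreover obtain y where "y \<in> s j" "norm (y - x) \<le> \<epsilon> j + e / 2"
          using near[of x j "e / 2"] \<open>e > 0\<close> x by auto
        ultimately show ?thesis by (auto simp: dist_norm intro!: bexI[of _ y])
      qed
      then show "x \<in> closure (\<Union>j. s j)" by (simp add: closure_approachable)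
    qed
  qed
  \<comment> \<open>Where one set includes the other, each point of the smaller one is its own
    approximant.\<close>
  have trivial: "\<exists>d\<in>D. norm (a - d) \<le> \<epsilon> j + \<delta>" if "a \<in> D" "\<delta> > 0"
    for D :: "'a set" and a j \<delta>
    using that nonneg[of j] by (intro bexI[of _ a]) auto
  show "hausdorff_tendsto s ?U"
  proof (rule hausdorff_tendsto_if_le[OF closed_s U _ lim], rule hausdorff_dist_le[OF _ _ nonneg])
    fix j a and \<delta> :: real assume "a \<in> s j" "\<delta> > 0"
    then show "\<exists>d\<in>?U. norm (a - d) \<le> \<epsilon> j + \<delta>" using s_U by (intro trivial) blast+
  next
    fix j d and \<delta> :: real assume "d \<in> ?U" "\<delta> > 0"
    then show "\<exists>a\<in>s j. norm (a - d) \<le> \<epsilon> j + \<delta>" using U_S by (intro near) blast+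
  qed
  show "hausdorff_tendsto S ?U"
  proof (rule hausdorff_tendsto_if_le[OF closed_S U _ lim], rule hausdorff_dist_le[OF _ _ nonneg])
    fix j a and \<delta> :: real assume "a \<in> S j" "\<delta> > 0"
    then obtain y where "y \<in> s j" "norm (y - a) \<le> \<epsilon> j + \<delta>" using near by blast
    then show "\<exists>d\<in>?U. norm (a - d) \<le> \<epsilon> j + \<delta>"
      using s_U by (metis norm_minus_commute subsetD)
  next
    fix j d and \<delta> :: real assume "d \<in> ?U" "\<delta> > 0"
    then show "\<exists>a\<in>S j. norm (a - d) \<le> \<epsilon> j + \<delta>"
      using trivial[of d "S j" \<delta> j] by (auto simp: norm_minus_commute)
  qed
qed

section \<open>Points and mesh of a partition\<close>

lemma partition_nth:
  assumes "is_partition p a b"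
  shows "p ! 0 = a" and "p ! (length p - 1) = b"
    and "\<And>i j. i \<le> j \<Longrightarrow> j < length p \<Longrightarrow> p ! i \<le> p ! j"
proof -
  show "p ! 0 = a" "p ! (length p - 1) = b"
    using assms by (auto simp: is_partition_def hd_conv_nth last_conv_nth)
  show "p ! i \<le> p ! j" if "i \<le> j" "j < length p" for i j
    using assms sorted_wrt_nth_less[of "(<)" p i j] that
    by (cases "i = j") (auto simp: is_partition_def)
qed

lemma partition_nth_mem:
  assumes "is_partition p a b" "i < length p"
  shows "p ! i \<in> {a..b}"
  using partition_nth(1,2)[OF assms(1)] partition_nth(3)[OF assms(1), of 0 i]
    partition_nth(3)[OF assms(1), of i "length p - 1"] assms(2)
  by auto

lemma mesh_ge:
  assumes "i \<in> {1..<length p}"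
  shows "p ! i - p ! (i - 1) \<le> mesh p"
  unfolding mesh_def by (rule Max_ge) (use assms in auto)

lemma mesh_nonneg: "0 \<le> mesh p"
  unfolding mesh_def by (rule Max_ge) auto

section \<open>Closed Minkowski sums\<close>

lemma closed_minkowski_sum_subset_iff:
  assumes "closed D"
  shows "A \<oplus>\<^sub>c C \<subseteq> D \<longleftrightarrow> (\<forall>x\<in>A. \<forall>y\<in>C. x + y \<in> D)"
proof -
  have "A \<oplus>\<^sub>c C \<subseteq> D \<longleftrightarrow> A + C \<subseteq> D"
    unfolding closed_minkowski_sum_def
    using assms closure_minimal closure_subset by (metis order_trans)
  then show ?thesis by (auto simp: set_plus_def)
qed

lemma add_mem_closed_minkowski_sum:
  "x \<in> A \<Longrightarrow> y \<in> C \<Longrightarrow> x + y \<in> A \<oplus>\<^sub>c C"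
  unfolding closed_minkowski_sum_def by (meson closure_subset set_plus_intro subsetD)

text \<open>First z is replaced by a genuine sum x + y at cost \<delta>; then x is kept and only y
  is moved into D, at cost \<epsilon>.\<close>

lemma closed_minkowski_sum_near:
  fixes A C D :: "'a::real_normed_vector set"
  assumes z: "z \<in> A \<oplus>\<^sub>c C" and "\<delta> > 0"
    and near: "\<And>y. y \<in> C \<Longrightarrow> \<exists>y'\<in>D. norm (y' - y) \<le> \<epsilon>"
  shows "\<exists>z'\<in>A \<oplus>\<^sub>c D. norm (z' - z) \<le> \<epsilon> + \<delta>"
proof -
  obtain x y where xy: "x \<in> A" "y \<in> C" "dist (x + y) z < \<delta>"
    using z \<open>\<delta> > 0\<close> unfolding closed_minkowski_sum_def closure_approachable
    by (auto simp: set_plus_def)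
  obtain y' where y': "y' \<in> D" "norm (y' - y) \<le> \<epsilon>" using near xy by blast
  have "norm (x + y' - z) \<le> norm (y' - y) + norm (x + y - z)"
    using norm_triangle_ineq[of "y' - y" "x + y - z"] by (simp add: algebra_simps)
  also have "\<dots> \<le> \<epsilon> + \<delta>" using xy y' by (simp add: dist_norm)
  finally show ?thesis using add_mem_closed_minkowski_sum xy y' by blast
qed

section \<open>Dependence of the Aumann integral on its lower limit\<close>

text \<open>Setting a selection to 0 before a' leaves its integral over [a', b] unchanged, and the
  result is still a selection because 0 lies in every value of H.\<close>

lemma aumann_integral_antimono_lower:
  assumes zero: "\<And>\<tau>. \<tau> \<in> {t0..T} \<Longrightarrow> 0 \<in> H \<tau>" and "a \<le> a'"
  shows "aumann_integral t0 T H a' b \<subseteq> aumann_integral t0 T H a b"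
proof
  fix y assume "y \<in> aumann_integral t0 T H a' b"
  then obtain g where y: "y = (LINT \<tau>:{a'..b}|lebesgue. g \<tau>)"
    and int: "set_integrable lebesgue {t0..T} g"
    and AE: "AE \<tau>\<in>{t0..T} in lebesgue. g \<tau> \<in> H \<tau>"
    unfolding aumann_integral_def by blast
  define g' where "g' \<tau> = indicator {a'..} \<tau> *\<^sub>R g \<tau>" for \<tau>
  have "integrable lebesgue (\<lambda>\<tau>. indicator {a'..} \<tau> *\<^sub>R (indicator {t0..T} \<tau> *\<^sub>R g \<tau>))"
    using int unfolding set_integrable_def by (rule integrable_mult_indicator[rotated]) auto
  then have "set_integrable lebesgue {t0..T} g'"
    unfolding set_integrable_def g'_def by (simp add: mult.commute)
  moreover have "AE \<tau>\<in>{t0..T} in lebesgue. g' \<tau> \<in> H \<tau>"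
    using AE by eventually_elim (auto simp: g'_def zero indicator_def)
  moreover have "(LINT \<tau>:{a..b}|lebesgue. g' \<tau>) = y"
    unfolding y set_lebesgue_integral_def g'_def
    using \<open>a \<le> a'\<close> by (intro Bochner_Integration.integral_cong) (auto simp: indicator_def)
  ultimately show "y \<in> aumann_integral t0 T H a b"
    unfolding aumann_integral_def by blast
qed

lemma zero_mem_aumann_integral:
  assumes "\<And>\<tau>. \<tau> \<in> {t0..T} \<Longrightarrow> 0 \<in> H \<tau>"
  shows "0 \<in> aumann_integral t0 T H a b"
  unfolding aumann_integral_def
  by (rule CollectI, rule exI[of _ "\<lambda>_. 0"])
    (use assms in \<open>auto simp: set_integrable_def set_lebesgue_integral_def\<close>)

text \<open>The same selection is integrated over both intervals, so the two integrals differ by its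
  integral over a piece of length a' - a, where its norm is at most C almost everywhere.\<close>

lemma aumann_integral_near:
  fixes H :: "real \<Rightarrow> 'a::{banach, second_countable_topology} set"
  assumes bound: "\<And>\<tau> x. \<tau> \<in> {t0..T} \<Longrightarrow> x \<in> H \<tau> \<Longrightarrow> norm x \<le> C"
    and le: "t0 \<le> a" "a \<le> a'" "a' \<le> b" "b \<le> T"
    and y: "y \<in> aumann_integral t0 T H a b"
  shows "\<exists>y'\<in>aumann_integral t0 T H a' b. norm (y' - y) \<le> C * (a' - a)"
proof -
  obtain g where y_eq: "y = (LINT \<tau>:{a..b}|lebesgue. g \<tau>)"
    and int: "set_integrable lebesgue {t0..T} g"
    and AE: "AE \<tau>\<in>{t0..T} in lebesgue. g \<tau> \<in> H \<tau>"
    using y unfolding aumann_integral_def by blast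
  define y' where "y' = (LINT \<tau>:{a'..b}|lebesgue. g \<tau>)"
  have "y' \<in> aumann_integral t0 T H a' b"
    using int AE unfolding aumann_integral_def y'_def by blast
  moreover have "norm (y' - y) \<le> C * (a' - a)"
  proof -
    \<comment> \<open>The half-open left piece makes the two pieces disjoint, so the integral over
      [a, b] splits additively.\<close>
    have int_ab: "set_integrable lebesgue {a..<a'} g" "set_integrable lebesgue {a'..b} g"
      by (rule set_integrable_subset[OF int]; use le in auto)+
    have "{a..b} = {a..<a'} \<union> {a'..b}" using le by auto
    then have "y = (LINT \<tau>:{a..<a'}|lebesgue. g \<tau>) + y'"
      unfolding y_eq y'_def using int_ab by (simp add: set_integral_Un ivl_disj_int)
    then have "norm (y' - y) = norm (LINT \<tau>:{a..<a'}|lebesgue. g \<tau>)"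
      by simp
    also have "\<dots> \<le> (LINT \<tau>|lebesgue. norm (indicator {a..<a'} \<tau> *\<^sub>R g \<tau>))"
      unfolding set_lebesgue_integral_def by (rule integral_norm_bound)
    also have "\<dots> \<le> (LINT \<tau>|lebesgue. C * indicator {a..<a'} \<tau>)"
    proof (rule integral_mono_AE)
      show "integrable lebesgue (\<lambda>\<tau>. norm (indicator {a..<a'} \<tau> *\<^sub>R g \<tau>))"
        using int_ab(1) unfolding set_integrable_def by (rule integrable_norm)
      show "integrable lebesgue (\<lambda>\<tau>. C * indicator {a..<a'} \<tau>)"
        by (intro integrable_mult_right integrable_real_indicator) (auto simp: le)
      show "AE \<tau> in lebesgue. norm (indicator {a..<a'} \<tau> *\<^sub>R g \<tau>) \<le> C * indicator {a..<a'} \<tau>"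
        using AE
      proof eventually_elim
        case (elim \<tau>)
        then show ?case using bound[of \<tau> "g \<tau>"] le by (auto simp: indicator_def)
      qed
    qed
    also have "\<dots> = C * (a' - a)" using le by simp
    finally show ?thesis .
  qed
  ultimately show ?thesis by blast
qed

section \<open>Comparison of lower and upper sums\<close>

lemma closed_lower_sum: "closed (lower_sum t0 T Bo Go p t)"
  unfolding lower_sum_def closed_minkowski_sum_def by (intro closed_Un closed_UN) auto

lemma closed_upper_sum: "closed (upper_sum t0 T Bo Go p t)"
  unfolding upper_sum_def closed_minkowski_sum_def by (intro closed_Un closed_UN) auto

lemma lower_sum_subset_upper_sum:
  fixes Bo Go :: "real \<Rightarrow> 'a::{banach, second_countable_topology} set"
  assumes mono: "\<And>s s'. s \<in> {t0..t} \<Longrightarrow> s' \<in> {t0..t} \<Longrightarrow> s \<le> s' \<Longrightarrow> Bo s \<subseteq> Bo s'"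
    and zero: "\<And>\<tau>. \<tau> \<in> {t0..T} \<Longrightarrow> 0 \<in> Go \<tau>"
    and p: "is_partition p t0 t" and q: "is_partition q t0 t"
  shows "lower_sum t0 T Bo Go p t \<subseteq> upper_sum t0 T Bo Go q t"
proof -
  let ?I = "\<lambda>a. aumann_integral t0 T Go a t"
  \<comment> \<open>Both kinds of pieces of the lower sum are instances: s = t0 for the initial one
    and s = \<open>p ! i\<close> for an increment, of which only x \<in> \<open>Bo (p ! i)\<close>
    is used.\<close>
  have key: "x + y \<in> upper_sum t0 T Bo Go q t"
    if s: "s \<in> {t0..t}" and x: "x \<in> Bo s" and y: "y \<in> ?I s" for s x y
  proof -
    let ?P = "\<lambda>k. k < length q \<and> x \<in> Bo (q ! k)"
    define k where "k = (LEAST k. ?P k)"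
    \<comment> \<open>The least index exists because q ends at t, where x is present.\<close>
    have "x \<in> Bo t" using mono[of s t] s x by auto
    then have "?P (length q - 1)"
      using partition_nth(2)[OF q] q by (auto simp: is_partition_def)
    then have k: "?P k" unfolding k_def by (rule LeastI)
    show ?thesis
    proof (cases "k = 0")
      case True
      then have "x \<in> Bo t0" using k partition_nth(1)[OF q] by simp
      moreover have "y \<in> ?I t0"
        using aumann_integral_antimono_lower[of t0 T Go, OF zero, where a = t0 and a' = s and b = t] y s by auto
      ultimately show ?thesis
        unfolding upper_sum_def using add_mem_closed_minkowski_sum by blast
    next
      case False
      then have "\<not> ?P (k - 1)" unfolding k_def by (intro not_less_Least) auto
      \<comment> \<open>Minimality excludes x from the whole previous set, hence from its interior,
        which is all that \<open>increment\<close> removes.\<close>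
      then have notin: "x \<notin> Bo (q ! (k - 1))" using k by auto
      then have "x \<in> increment Bo q k"
        using k interior_subset unfolding increment_def by blast
      moreover have "q ! (k - 1) \<le> s"
        using mono[of s "q ! (k - 1)"] s x notin partition_nth_mem[OF q, of "k - 1"] k
        by force
      then have "y \<in> ?I (q ! (k - 1))"
        using aumann_integral_antimono_lower[of t0 T Go, OF zero, where a = "q ! (k - 1)" and a' = s and b = t] y by auto
      ultimately have "x + y \<in> increment Bo q k \<oplus>\<^sub>c ?I (q ! (k - 1))"
        by (rule add_mem_closed_minkowski_sum)
      moreover have "k \<in> {1..<length q}" using k False by auto
      ultimately show ?thesis unfolding upper_sum_def by blast
    qed
  qed
  have "t0 \<le> t" using partition_nth_mem[OF p, of 0] p by (auto simp: is_partition_def)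
  then have "Bo t0 \<oplus>\<^sub>c ?I t0 \<subseteq> upper_sum t0 T Bo Go q t"
    unfolding closed_minkowski_sum_subset_iff[OF closed_upper_sum] using key[of t0] by auto
  moreover have "increment Bo p i \<oplus>\<^sub>c ?I (p ! i) \<subseteq> upper_sum t0 T Bo Go q t"
    if "i \<in> {1..<length p}" for i
    unfolding closed_minkowski_sum_subset_iff[OF closed_upper_sum]
    using key[of "p ! i"] partition_nth_mem[OF p, of i] that by (auto simp: increment_def)
  ultimately show ?thesis unfolding lower_sum_def by blast
qed

text \<open>Both sums use the same increments, so they are compared piece by piece: only the lower
  limit of the integral moves, from \<open>p ! (i - 1)\<close> to \<open>p ! i\<close>, hence by at
  most the mesh. The bound does not depend on i.\<close>

lemma upper_sum_near_lower_sum: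
  fixes Bo Go :: "real \<Rightarrow> 'a::{banach, second_countable_topology} set"
  assumes bound: "\<And>\<tau> x. \<tau> \<in> {t0..T} \<Longrightarrow> x \<in> Go \<tau> \<Longrightarrow> norm x \<le> C" and "0 \<le> C"
    and p: "is_partition p t0 t" and "t \<le> T"
    and z: "z \<in> upper_sum t0 T Bo Go p t" and "\<delta> > 0"
  shows "\<exists>z'\<in>lower_sum t0 T Bo Go p t. norm (z' - z) \<le> C * mesh p + \<delta>"
proof (cases "z \<in> Bo t0 \<oplus>\<^sub>c aumann_integral t0 T Go t0 t")
  \<comment> \<open>The initial piece is common to both sums, so z approximates itself.\<close>
  case True
  then show ?thesis
    unfolding lower_sum_def using \<open>\<delta> > 0\<close> \<open>0 \<le> C\<close> mesh_nonneg[of p]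
    by (intro bexI[of _ z]) auto
next
  case False
  then obtain i where i: "i \<in> {1..<length p}"
    and z: "z \<in> increment Bo p i \<oplus>\<^sub>c aumann_integral t0 T Go (p ! (i - 1)) t"
    using z unfolding upper_sum_def by blast
  have "\<exists>z'\<in>increment Bo p i \<oplus>\<^sub>c aumann_integral t0 T Go (p ! i) t. norm (z' - z) \<le> C * mesh p + \<delta>"
  proof (rule closed_minkowski_sum_near[OF z \<open>\<delta> > 0\<close>])
    fix y assume y: "y \<in> aumann_integral t0 T Go (p ! (i - 1)) t"
    have "\<exists>y'\<in>aumann_integral t0 T Go (p ! i) t. norm (y' - y) \<le> C * (p ! i - p ! (i - 1))"
      using partition_nth_mem[OF p, of i] partition_nth_mem[OF p, of "i - 1"]
        partition_nth(3)[OF p, of "i - 1" i] i \<open>t \<le> T\<close>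
      by (intro aumann_integral_near[OF bound _ _ _ _ y]) auto
    moreover have "C * (p ! i - p ! (i - 1)) \<le> C * mesh p"
      using mesh_ge[OF i] \<open>0 \<le> C\<close> by (rule mult_left_mono)
    ultimately show "\<exists>y'\<in>aumann_integral t0 T Go (p ! i) t. norm (y' - y) \<le> C * mesh p"
      by force
  qed
  then show ?thesis unfolding lower_sum_def using i by blast
qed

theorem corollary4p7:
  fixes M :: "'w measure" and F :: "real \<Rightarrow> 'w measure" and t0 T t :: real
    and B G :: "'w \<Rightarrow> real \<Rightarrow> 'a::{banach, second_countable_topology} set"
    and P :: "nat \<Rightarrow> real list"
  assumes "reflexive_space TYPE('a)" and "separable_dual TYPE('a)"
    and "usual_filtered_prob_space M F t0 T"
    and "nucleation_process M F t0 T B"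
    and "growth_process M F t0 T G"
    and "t \<in> {t0..T}"
    and "refinement_sequence P t0 t"
  shows "AE \<omega> in M. \<exists>Ls LS.
    hausdorff_tendsto (\<lambda>j. lower_sum t0 T (B \<omega>) (G \<omega>) (P j) t) Ls \<and>
    hausdorff_tendsto (\<lambda>j. upper_sum t0 T (B \<omega>) (G \<omega>) (P j) t) LS \<and>
    closure (\<Union>j. lower_sum t0 T (B \<omega>) (G \<omega>) (P j) t) = closure Ls \<and>
    closure Ls = LS \<and>
    LS = (\<Inter>j. upper_sum t0 T (B \<omega>) (G \<omega>) (P j) t)"
proof (rule AE_I2)
  fix \<omega> assume \<omega>: "\<omega> \<in> space M"
  let ?s = "\<lambda>j. lower_sum t0 T (B \<omega>) (G \<omega>) (P j) t"
  let ?S = "\<lambda>j. upper_sum t0 T (B \<omega>) (G \<omega>) (P j) t"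
  obtain K where K: "bounded K" "\<And>\<tau>. \<tau> \<in> {t0..T} \<Longrightarrow> G \<omega> \<tau> \<subseteq> K"
    using assms(5) \<omega> unfolding growth_process_def by blast
  obtain C where C: "C > 0" "\<And>x. x \<in> K \<Longrightarrow> norm x \<le> C"
    using K(1) unfolding bounded_pos by blast
  have bound: "norm x \<le> C" if "\<tau> \<in> {t0..T}" "x \<in> G \<omega> \<tau>" for \<tau> x
    using K(2) C(2) that by blast
  have zero: "0 \<in> G \<omega> \<tau>" if "\<tau> \<in> {t0..T}" for \<tau>
    using assms(5) \<omega> that unfolding growth_process_def by blast
  \<comment> \<open>A nucleation process is monotone along strictly increasing times; equal times
    are split off.\<close>
  have mono: "B \<omega> s \<subseteq> B \<omega> s'" if "s \<in> {t0..t}" "s' \<in> {t0..t}" "s \<le> s'" for s s'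
    using assms(4,6) \<omega> that unfolding nucleation_process_def by (cases "s = s'") auto
  have P: "is_partition (P j) t0 t" for j
    using assms(7) unfolding refinement_sequence_def by blast
  have sub: "?s i \<subseteq> ?S j" for i j
    using mono zero P P by (rule lower_sum_subset_upper_sum)
  have "t0 \<in> {t0..T}" using assms(6) by simp
  then have "B \<omega> t0 \<in> closed_sets"
    using assms(4) \<omega> unfolding nucleation_process_def by blast
  then obtain b where "b \<in> B \<omega> t0" unfolding closed_sets_def by blast
  moreover have "0 \<in> aumann_integral t0 T (G \<omega>) t0 t"
    using zero by (rule zero_mem_aumann_integral)
  \<comment> \<open>This common point makes every lower sum nonempty, and through \<open>sub\<close>
    every upper sum as well, as membership in \<open>closed_sets\<close> demands.\<close>
  ultimately have "b + 0 \<in> ?s j" for j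
    unfolding lower_sum_def by (intro UnI1 add_mem_closed_minkowski_sum)
  then have closed: "?s j \<in> closed_sets" "?S j \<in> closed_sets" for j
    using sub[of j j] closed_lower_sum closed_upper_sum unfolding closed_sets_def by blast+
  have near: "\<exists>y\<in>?s j. norm (y - x) \<le> C * mesh (P j) + \<delta>" if "x \<in> ?S j" "\<delta> > 0" for j x \<delta>
    using upper_sum_near_lower_sum[OF bound _ P _ that] C(1) assms(6) by simp
  have "0 \<le> C * mesh (P j)" for j using C(1) mesh_nonneg by simp
  moreover have "(\<lambda>j. C * mesh (P j)) \<longlonglongrightarrow> 0"
    using assms(7) tendsto_mult_right_zero unfolding refinement_sequence_def by blast
  ultimately have *: "hausdorff_tendsto ?s (\<Inter>j. ?S j)" "hausdorff_tendsto ?S (\<Inter>j. ?S j)"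
    "closure (\<Union>j. ?s j) = (\<Inter>j. ?S j)"
    using hausdorff_limit_between[where s = ?s and S = ?S, OF closed sub near] by simp_all
  \<comment> \<open>The intersection serves as both limits; being itself a closure, it is unchanged
    by the closure taken of \<open>Ls\<close>.\<close>
  moreover have "closure (\<Inter>j. ?S j) = (\<Inter>j. ?S j)"
    using *(3) closure_closure by metis
  ultimately show "\<exists>Ls LS. hausdorff_tendsto ?s Ls \<and> hausdorff_tendsto ?S LS \<and>
    closure (\<Union>j. ?s j) = closure Ls \<and> closure Ls = LS \<and> LS = (\<Inter>j. ?S j)"
    by (intro exI[of _ "\<Inter>j. ?S j"]) simp
qed

end
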